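(* Let $\Gamma=(V,E,o,t)$ be a connected locally finite graph. Then the map $\iota_0\colon\mathbb{Z}[V]\to\mathbb{Z}^V$ induces homomorphisms $\iota\colon\mathrm{Cl}(\Gamma)\to\widehat{\mathrm{Cl}}(\Gamma)$ and $\iota^0\colon\mathrm{Cl}^0(\Gamma)\to\widehat{\mathrm{Cl}}{}^0(\Gamma)$ compatible with the inclusions $\mathrm{Cl}^0(\Gamma)\subset\mathrm{Cl}(\Gamma)$, $\widehat{\mathrm{Cl}}{}^0(\Gamma)\subset\widehat{\mathrm{Cl}}(\Gamma)$, and $\chi\circ\zeta\circ\mathrm{AJ}=\iota^0$. If $\Gamma$ is finite, then $\iota$, $\iota^0$ and $\zeta$ are isomorphisms.
   Context: Graph: $V\ne\emptyset$, $E$, $o,t\colon E\to V$, locally finite, countable. $\partial=t-o\colon\mathbb{Z}[E]\to\mathbb{Z}[V]$, $H_1(\Gamma)=\ker\partial$; $\partial^*\colon\mathbb{Z}[V]\to\mathbb{Z}[E]$, $v\mapsto\sum_{t(e)=v}e-\sum_{o(e)=v}e$; $\Delta_0=\partial\partial^*$. $d\colon\mathbb{Z}^V\to\mathbb{Z}^E$, $(df)(e)=f(t(e))-f(o(e))$, $H^1(\Gamma)=\mathbb{Z}^E/d\mathbb{Z}^V=\mathrm{Hom}(H_1(\Gamma),\mathbb{Z})$; $d^*\colon\mathbb{Z}^E\to\mathbb{Z}^V$, $(d^*\omega)(v)=\sum_{t(e)=v}\omega(e)-\sum_{o(e)=v}\omega(e)$; $\square_0=d^*d$; $\mathcal{H}^1(\Gamma)=\ker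 d^*$. $\iota_0,\iota_1$ send a vertex/edge to its characteristic function. Class groups: $\mathrm{Cl}(\Gamma)=\mathbb{Z}[V]/\Delta_0\mathbb{Z}[V]\supset\mathrm{Cl}^0(\Gamma)=\mathbb{Z}[V]_0/\Delta_0\mathbb{Z}[V]$; $\widehat{\mathrm{Cl}}(\Gamma)=\mathbb{Z}^V/\square_0\mathbb{Z}^V\supset\widehat{\mathrm{Cl}}{}^0(\Gamma)=\operatorname{im}(d^* )/\square_0\mathbb{Z}^V$. $M^\vee=\mathrm{Hom}(M,\mathbb{Z})$; $\alpha\colon H_1\to\mathcal{H}^1(\Gamma)^\vee$, $\gamma\mapsto(\omega\mapsto\omega(\gamma))$; $\beta\colon\mathcal{H}^1\to H^1$ natural map. $\mathrm{J}(\Gamma)=\mathcal{H}^1(\Gamma)^\vee/\alpha(H_1)$, $\mathrm{P}(\Gamma)=H^1(\Gamma)/\beta(\mathcal{H}^1)$. $\mathrm{AJ}\colon\mathrm{Cl}^0(\Gamma)\to\mathrm{J}(\Gamma)$ sends the class of $D=\partial\gamma$ to the class of $\omega\mapsto\omega(\gamma)$ (an isomorphism). $\zeta\colon\mathrm{J}(\Gamma)\to\mathrm{P}(\Gamma)$ is induced by the transpose ${}^t\iota\colon\mathcal{H}^1(\Gamma)^\vee\to\mathrm{Hom}(H_1,\mathbb{Z})=H^1(\Gamma)$ of $\iota_1|_{H_1}\colon H_1(\Gamma)\to\mathcal{H}^1(\Gamma)$. $\chi\colon\mathrm{P}(\Gamma)\to\widehat{\mathrm{Cl}}{}^0(\Gamma)$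 is the isomorphism induced by $d^*$. *)

theory Defs
  imports
    "Graph_Theory.Graph_Theory"
    "HOL-Algebra.Free_Abelian_Groups"
    "HOL-Library.Countable_Set"
begin

text \<open>
  A graph \<open>(V, E, o, t)\<close> is a \<open>pre_digraph\<close> with \<open>V = verts\<close>, \<open>E = arcs\<close>, \<open>o = tail\<close>,
  \<open>t = head\<close>; loops and multiple edges are allowed.
\<close>

locale locally_finite_graph = wf_digraph \<Gamma> for \<Gamma> :: "('v, 'e) pre_digraph" +
  assumes verts_nonempty: "verts \<Gamma> \<noteq> {}"
    and countable_verts: "countable (verts \<Gamma>)"
    and countable_arcs: "countable (arcs \<Gamma>)"
    and finite_in_arcs_at: "v \<in> verts \<Gamma> \<Longrightarrow> finite (in_arcs \<Gamma> v)"
    and finite_out_arcs_at: "v \<in> verts \<Gamma> \<Longrightarrow> finite (out_arcs \<Gamma> v)"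

text \<open>
  \<open>chain_group S\<close> is the group \<open>\<int>[S]\<close> and \<open>cochain_group S\<close> the group \<open>\<int>\<^sup>S\<close>; elements of the
  latter are functions on \<open>S\<close> extended by \<open>undefined\<close>.
\<close>

abbreviation chain_group :: "'a set \<Rightarrow> ('a \<Rightarrow>\<^sub>0 int) monoid" where
  "chain_group S \<equiv> free_Abelian_group S"

abbreviation cochain_group :: "'a set \<Rightarrow> ('a \<Rightarrow> int) monoid" where
  "cochain_group S \<equiv> product_group S (\<lambda>_. integer_group)"

definition char_fun :: "'a set \<Rightarrow> ('a \<Rightarrow>\<^sub>0 int) \<Rightarrow> 'a \<Rightarrow> int" where
  "char_fun S c = (\<lambda>x\<in>S. Poly_Mapping.lookup c x)"

definition iota0 :: "('v, 'e) pre_digraph \<Rightarrow> ('v \<Rightarrow>\<^sub>0 int) \<Rightarrow> 'v \<Rightarrow> int" where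
  "iota0 \<Gamma> = char_fun (verts \<Gamma>)"

definition iota1 :: "('v, 'e) pre_digraph \<Rightarrow> ('e \<Rightarrow>\<^sub>0 int) \<Rightarrow> 'e \<Rightarrow> int" where
  "iota1 \<Gamma> = char_fun (arcs \<Gamma>)"

definition pairing :: "('a \<Rightarrow> int) \<Rightarrow> ('a \<Rightarrow>\<^sub>0 int) \<Rightarrow> int" where
  "pairing \<omega> \<gamma> = (\<Sum>x\<in>Poly_Mapping.keys \<gamma>. Poly_Mapping.lookup \<gamma> x * \<omega> x)"

definition dual_group :: "('a, 'b) monoid_scheme \<Rightarrow> ('a \<Rightarrow> int) monoid" where
  "dual_group M =
    \<lparr>carrier = hom M integer_group \<inter> extensional (carrier M),
     monoid.mult = (\<lambda>f g. \<lambda>x\<in>carrier M. f x + g x),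
     one = (\<lambda>x\<in>carrier M. 0)\<rparr>"

text \<open>
  The value on a coset of the map out of a quotient induced by \<open>f\<close>; meaningful when \<open>f\<close> is
  constant on cosets.
\<close>

definition induced :: "('a \<Rightarrow> 'b) \<Rightarrow> 'a set \<Rightarrow> 'b" where
  "induced f X = the_elem (f ` X)"


definition bd :: "('v, 'e) pre_digraph \<Rightarrow> ('e \<Rightarrow>\<^sub>0 int) \<Rightarrow> 'v \<Rightarrow>\<^sub>0 int" where
  "bd \<Gamma> = frag_extend (\<lambda>e. frag_of (head \<Gamma> e) - frag_of (tail \<Gamma> e))"

definition bd_adj :: "('v, 'e) pre_digraph \<Rightarrow> ('v \<Rightarrow>\<^sub>0 int) \<Rightarrow> 'e \<Rightarrow>\<^sub>0 int" where
  "bd_adj \<Gamma> = frag_extend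
     (\<lambda>v. (\<Sum>e\<in>in_arcs \<Gamma> v. frag_of e) - (\<Sum>e\<in>out_arcs \<Gamma> v. frag_of e))"

definition laplace0 :: "('v, 'e) pre_digraph \<Rightarrow> ('v \<Rightarrow>\<^sub>0 int) \<Rightarrow> 'v \<Rightarrow>\<^sub>0 int" where
  "laplace0 \<Gamma> = bd \<Gamma> \<circ> bd_adj \<Gamma>"

definition cobd :: "('v, 'e) pre_digraph \<Rightarrow> ('v \<Rightarrow> int) \<Rightarrow> 'e \<Rightarrow> int" where
  "cobd \<Gamma> f = (\<lambda>e\<in>arcs \<Gamma>. f (head \<Gamma> e) - f (tail \<Gamma> e))"

definition cobd_adj :: "('v, 'e) pre_digraph \<Rightarrow> ('e \<Rightarrow> int) \<Rightarrow> 'v \<Rightarrow> int" where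
  "cobd_adj \<Gamma> \<omega> = (\<lambda>v\<in>verts \<Gamma>. (\<Sum>e\<in>in_arcs \<Gamma> v. \<omega> e) - (\<Sum>e\<in>out_arcs \<Gamma> v. \<omega> e))"

definition box0 :: "('v, 'e) pre_digraph \<Rightarrow> ('v \<Rightarrow> int) \<Rightarrow> 'v \<Rightarrow> int" where
  "box0 \<Gamma> = cobd_adj \<Gamma> \<circ> cobd \<Gamma>"


definition im_laplace0 :: "('v, 'e) pre_digraph \<Rightarrow> ('v \<Rightarrow>\<^sub>0 int) set" where
  "im_laplace0 \<Gamma> = laplace0 \<Gamma> ` carrier (chain_group (verts \<Gamma>))"

definition im_box0 :: "('v, 'e) pre_digraph \<Rightarrow> ('v \<Rightarrow> int) set" where
  "im_box0 \<Gamma> = box0 \<Gamma> ` carrier (cochain_group (verts \<Gamma>))"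

definition im_cobd :: "('v, 'e) pre_digraph \<Rightarrow> ('e \<Rightarrow> int) set" where
  "im_cobd \<Gamma> = cobd \<Gamma> ` carrier (cochain_group (verts \<Gamma>))"

definition chain_group_deg0 :: "('v, 'e) pre_digraph \<Rightarrow> ('v \<Rightarrow>\<^sub>0 int) monoid" where
  "chain_group_deg0 \<Gamma> = (chain_group (verts \<Gamma>))
     \<lparr>carrier := {D \<in> carrier (chain_group (verts \<Gamma>)).
                    (\<Sum>v\<in>Poly_Mapping.keys D. Poly_Mapping.lookup D v) = 0}\<rparr>"

definition cochain_group_im :: "('v, 'e) pre_digraph \<Rightarrow> ('v \<Rightarrow> int) monoid" where
  "cochain_group_im \<Gamma> = (cochain_group (verts \<Gamma>))
     \<lparr>carrier := cobd_adj \<Gamma> ` carrier (cochain_group (arcs \<Gamma>))\<rparr>"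

definition Cl :: "('v, 'e) pre_digraph \<Rightarrow> ('v \<Rightarrow>\<^sub>0 int) set monoid" where
  "Cl \<Gamma> = chain_group (verts \<Gamma>) Mod im_laplace0 \<Gamma>"

definition Cl0 :: "('v, 'e) pre_digraph \<Rightarrow> ('v \<Rightarrow>\<^sub>0 int) set monoid" where
  "Cl0 \<Gamma> = chain_group_deg0 \<Gamma> Mod im_laplace0 \<Gamma>"

definition Clhat :: "('v, 'e) pre_digraph \<Rightarrow> ('v \<Rightarrow> int) set monoid" where
  "Clhat \<Gamma> = cochain_group (verts \<Gamma>) Mod im_box0 \<Gamma>"

definition Clhat0 :: "('v, 'e) pre_digraph \<Rightarrow> ('v \<Rightarrow> int) set monoid" where
  "Clhat0 \<Gamma> = cochain_group_im \<Gamma> Mod im_box0 \<Gamma>"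

text \<open>
  Cosets in the subgroups are literally cosets in the ambient groups, so the inclusions of the
  degree-zero class groups are inclusions of carriers.
\<close>

lemma carrier_Cl0_subset: "carrier (Cl0 \<Gamma>) \<subseteq> carrier (Cl \<Gamma>)"
  by (auto simp: Cl0_def Cl_def chain_group_deg0_def carrier_FactGroup r_coset_def)

lemma carrier_Clhat0_subset: "carrier (Clhat0 \<Gamma>) \<subseteq> carrier (Clhat \<Gamma>)"
  by (auto simp: Clhat0_def Clhat_def cochain_group_im_def cobd_adj_def carrier_FactGroup r_coset_def)


definition H_lower1 :: "('v, 'e) pre_digraph \<Rightarrow> ('e \<Rightarrow>\<^sub>0 int) monoid" where
  "H_lower1 \<Gamma> = (chain_group (arcs \<Gamma>))
     \<lparr>carrier := kernel (chain_group (arcs \<Gamma>)) (chain_group (verts \<Gamma>)) (bd \<Gamma>)\<rparr>"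

definition H_upper1 :: "('v, 'e) pre_digraph \<Rightarrow> ('e \<Rightarrow> int) set monoid" where
  "H_upper1 \<Gamma> = cochain_group (arcs \<Gamma>) Mod im_cobd \<Gamma>"

definition Harm1 :: "('v, 'e) pre_digraph \<Rightarrow> ('e \<Rightarrow> int) monoid" where
  "Harm1 \<Gamma> = (cochain_group (arcs \<Gamma>))
     \<lparr>carrier := kernel (cochain_group (arcs \<Gamma>)) (cochain_group (verts \<Gamma>)) (cobd_adj \<Gamma>)\<rparr>"

text \<open>The identification of \<open>H_upper1 \<Gamma>\<close> with the dual of \<open>H_lower1 \<Gamma>\<close>.\<close>

definition H_upper1_to_dual ::
    "('v, 'e) pre_digraph \<Rightarrow> ('e \<Rightarrow> int) set \<Rightarrow> ('e \<Rightarrow>\<^sub>0 int) \<Rightarrow> int" where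
  "H_upper1_to_dual \<Gamma> = induced (\<lambda>\<omega>. \<lambda>\<gamma>\<in>carrier (H_lower1 \<Gamma>). pairing \<omega> \<gamma>)"

definition dual_to_H_upper1 ::
    "('v, 'e) pre_digraph \<Rightarrow> (('e \<Rightarrow>\<^sub>0 int) \<Rightarrow> int) \<Rightarrow> ('e \<Rightarrow> int) set" where
  "dual_to_H_upper1 \<Gamma> = inv_into (carrier (H_upper1 \<Gamma>)) (H_upper1_to_dual \<Gamma>)"

definition eval_harm :: "('v, 'e) pre_digraph \<Rightarrow> ('e \<Rightarrow>\<^sub>0 int) \<Rightarrow> ('e \<Rightarrow> int) \<Rightarrow> int" where
  "eval_harm \<Gamma> \<gamma> = (\<lambda>\<omega>\<in>carrier (Harm1 \<Gamma>). pairing \<omega> \<gamma>)"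

definition im_alpha :: "('v, 'e) pre_digraph \<Rightarrow> (('e \<Rightarrow> int) \<Rightarrow> int) set" where
  "im_alpha \<Gamma> = eval_harm \<Gamma> ` carrier (H_lower1 \<Gamma>)"

definition im_beta :: "('v, 'e) pre_digraph \<Rightarrow> ('e \<Rightarrow> int) set set" where
  "im_beta \<Gamma> = (\<lambda>\<omega>. im_cobd \<Gamma> #>\<^bsub>cochain_group (arcs \<Gamma>)\<^esub> \<omega>) ` carrier (Harm1 \<Gamma>)"

definition Jgrp :: "('v, 'e) pre_digraph \<Rightarrow> (('e \<Rightarrow> int) \<Rightarrow> int) set monoid" where
  "Jgrp \<Gamma> = dual_group (Harm1 \<Gamma>) Mod im_alpha \<Gamma>"

definition Pgrp :: "('v, 'e) pre_digraph \<Rightarrow> ('e \<Rightarrow> int) set set monoid" where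
  "Pgrp \<Gamma> = H_upper1 \<Gamma> Mod im_beta \<Gamma>"


text \<open>
  \<open>AJ\<close> takes the common class in \<open>Jgrp \<Gamma>\<close> of all \<open>eval_harm \<Gamma> \<gamma>\<close> with \<open>bd \<Gamma> \<gamma>\<close> in the given
  divisor class.
\<close>

definition AJ :: "('v, 'e) pre_digraph \<Rightarrow> ('v \<Rightarrow>\<^sub>0 int) set \<Rightarrow> (('e \<Rightarrow> int) \<Rightarrow> int) set" where
  "AJ \<Gamma> X = induced (\<lambda>\<gamma>. im_alpha \<Gamma> #>\<^bsub>dual_group (Harm1 \<Gamma>)\<^esub> eval_harm \<Gamma> \<gamma>)
     {\<gamma> \<in> carrier (chain_group (arcs \<Gamma>)). bd \<Gamma> \<gamma> \<in> X}"

definition iota_transpose ::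
    "('v, 'e) pre_digraph \<Rightarrow> (('e \<Rightarrow> int) \<Rightarrow> int) \<Rightarrow> ('e \<Rightarrow>\<^sub>0 int) \<Rightarrow> int" where
  "iota_transpose \<Gamma> \<phi> = (\<lambda>\<gamma>\<in>carrier (H_lower1 \<Gamma>). \<phi> (iota1 \<Gamma> \<gamma>))"

definition zeta :: "('v, 'e) pre_digraph \<Rightarrow> (('e \<Rightarrow> int) \<Rightarrow> int) set \<Rightarrow> ('e \<Rightarrow> int) set set" where
  "zeta \<Gamma> = induced
     (\<lambda>\<phi>. im_beta \<Gamma> #>\<^bsub>H_upper1 \<Gamma>\<^esub> dual_to_H_upper1 \<Gamma> (iota_transpose \<Gamma> \<phi>))"

text \<open>\<open>Pgrp \<Gamma>\<close> is a quotient of a quotient, so \<open>cobd_adj\<close> is passed to cosets twice.\<close>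

definition chi :: "('v, 'e) pre_digraph \<Rightarrow> ('e \<Rightarrow> int) set set \<Rightarrow> ('v \<Rightarrow> int) set" where
  "chi \<Gamma> = induced (induced (\<lambda>\<omega>. im_box0 \<Gamma> #>\<^bsub>cochain_group_im \<Gamma>\<^esub> cobd_adj \<Gamma> \<omega>))"

definition iota_Cl :: "('v, 'e) pre_digraph \<Rightarrow> ('v \<Rightarrow>\<^sub>0 int) set \<Rightarrow> ('v \<Rightarrow> int) set" where
  "iota_Cl \<Gamma> = induced (\<lambda>D. im_box0 \<Gamma> #>\<^bsub>cochain_group (verts \<Gamma>)\<^esub> iota0 \<Gamma> D)"

definition iota_Cl0 :: "('v, 'e) pre_digraph \<Rightarrow> ('v \<Rightarrow>\<^sub>0 int) set \<Rightarrow> ('v \<Rightarrow> int) set" where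
  "iota_Cl0 \<Gamma> = induced (\<lambda>D. im_box0 \<Gamma> #>\<^bsub>cochain_group_im \<Gamma>\<^esub> iota0 \<Gamma> D)"

end

theory Submission
  imports Defs
begin

text \<open>
  The characteristic function maps intertwine \<open>bd\<close> with \<open>cobd_adj\<close> and \<open>bd_adj\<close> with \<open>cobd\<close>, hence the
  two Laplacians, which gives \<open>\<iota>\<close> and \<open>\<iota>\<^sup>0\<close>. On a connected graph the degree-zero divisors are the
  boundaries, and the cycles are a direct summand of the chains, so that \<open>H\<^sup>1\<close> is the dual of \<open>H\<^sub>1\<close>.
  Symmetry of the pairing of two finite chains shows that the transpose of \<open>\<iota>\<^sub>1\<close> sends evaluation at
  \<open>\<gamma>\<close> to the class of \<open>\<iota>\<^sub>1 \<gamma>\<close>; thus \<open>\<chi> \<circ> \<zeta> \<circ> AJ\<close> sends the class of \<open>bd \<gamma>\<close> to that of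
  \<open>cobd_adj (\<iota>\<^sub>1 \<gamma>) = \<iota>\<^sub>0 (bd \<gamma>)\<close>. On a finite graph \<open>\<iota>\<^sub>0\<close> and \<open>\<iota>\<^sub>1\<close> are bijective, and so is every
  map they induce.
\<close>

section \<open>Maps induced on quotient groups\<close>

text \<open>\<open>the_elem\<close> returns a meaningful value only on a singleton, so every
  evaluation of \<open>induced\<close> rests on this nonemptiness and constancy.\<close>

lemma induced_const:
  assumes "X \<noteq> {}" and "\<And>x. x \<in> X \<Longrightarrow> f x = c"
  shows "induced f X = c"
proof -
  have "f ` X = {c}" using assms by auto
  then show ?thesis by (simp add: induced_def)
qed

text \<open>A member of the coset of \<open>x\<close> has the form n x with n in \<open>N\<close>,
  and \<open>f\<close> kills the factor n.\<close>

lemma induced_rcoset: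
  assumes G: "group G" and N: "subgroup N G" and H: "group H"
    and f: "f \<in> hom G H" and N1: "\<And>n. n \<in> N \<Longrightarrow> f n = \<one>\<^bsub>H\<^esub>"
    and x: "x \<in> carrier G"
  shows "induced f (N #>\<^bsub>G\<^esub> x) = f x"
proof (rule induced_const)
  show "N #>\<^bsub>G\<^esub> x \<noteq> {}"
    using group.rcos_self[OF G x N] by blast
  fix y assume "y \<in> N #>\<^bsub>G\<^esub> x"
  then obtain n where n: "n \<in> N" "y = n \<otimes>\<^bsub>G\<^esub> x"
    by (auto simp: r_coset_def)
  have "f y = f n \<otimes>\<^bsub>H\<^esub> f x"
    using hom_mult[OF f] n x subgroup.mem_carrier[OF N] by blast
  also have "\<dots> = f x"
    using N1[OF n(1)] hom_in_carrier[OF f x] H by (simp add: group.is_monoid monoid.l_one)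
  finally show "f y = f x" .
qed

text \<open>Commutativity makes \<open>N\<close> normal, so cosets multiply through representatives,
  where \<open>induced f\<close> agrees with \<open>f\<close>.\<close>

lemma induced_hom:
  assumes G: "comm_group G" and N: "subgroup N G" and H: "group H"
    and f: "f \<in> hom G H" and N1: "\<And>n. n \<in> N \<Longrightarrow> f n = \<one>\<^bsub>H\<^esub>"
  shows "induced f \<in> hom (G Mod N) H"
proof -
  have grp: "group G" using G by (rule comm_group.axioms)
  have nrm: "N \<lhd> G" using comm_group.subgroup_imp_normal[OF G N] .
  note val = induced_rcoset[OF grp N H f N1]
  show ?thesis
  proof (rule homI)
    fix X assume "X \<in> carrier (G Mod N)"
    then show "induced f X \<in> carrier H"
      using val hom_in_carrier[OF f] by (auto simp: carrier_FactGroup)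
  next
    fix X Y assume "X \<in> carrier (G Mod N)" "Y \<in> carrier (G Mod N)"
    then obtain x y where xy: "x \<in> carrier G" "X = N #>\<^bsub>G\<^esub> x" "y \<in> carrier G" "Y = N #>\<^bsub>G\<^esub> y"
      by (auto simp: carrier_FactGroup)
    have "X \<otimes>\<^bsub>G Mod N\<^esub> Y = N #>\<^bsub>G\<^esub> (x \<otimes>\<^bsub>G\<^esub> y)"
      using xy normal.rcos_sum[OF nrm] by simp
    then show "induced f (X \<otimes>\<^bsub>G Mod N\<^esub> Y) = induced f X \<otimes>\<^bsub>H\<^esub> induced f Y"
      using xy val hom_mult[OF f] grp by (simp add: group.is_monoid monoid.m_closed)
  qed
qed

lemma rcoset_hom:
  assumes H: "comm_group H" and M: "subgroup M H" and h: "h \<in> hom G H"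
  shows "(\<lambda>x. M #>\<^bsub>H\<^esub> h x) \<in> hom G (H Mod M)"
  using Group.hom_compose[OF h normal.r_coset_hom_Mod[OF comm_group.subgroup_imp_normal[OF H M]]]
  by (simp add: comp_def)

lemma rcoset_eq_one_iff:
  assumes "group H" "subgroup M H" "x \<in> carrier H"
  shows "M #>\<^bsub>H\<^esub> x = \<one>\<^bsub>H Mod M\<^esub> \<longleftrightarrow> x \<in> M"
  using assms group.coset_join1 group.coset_join2 by fastforce

lemma group_Mod:
  assumes "comm_group H" "subgroup M H"
  shows "group (H Mod M)"
  using comm_group.abelian_FactGroup[OF assms] by (rule comm_group.axioms)

text \<open>Composing \<open>h\<close> with the projection to \<open>H Mod M\<close> kills
  \<open>N\<close>. The maps \<open>iota_Cl\<close>, \<open>iota_Cl0\<close>, \<open>zeta\<close>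
  and the inner layer of \<open>chi\<close> all have this shape.\<close>

lemma induced_Mod_rcoset:
  assumes G: "comm_group G" and N: "subgroup N G" and H: "comm_group H" and M: "subgroup M H"
    and h: "h \<in> hom G H" and hN: "h ` N \<subseteq> M" and x: "x \<in> carrier G"
  shows "induced (\<lambda>x. M #>\<^bsub>H\<^esub> h x) (N #>\<^bsub>G\<^esub> x) = M #>\<^bsub>H\<^esub> h x"
proof (rule induced_rcoset[OF comm_group.axioms(2)[OF G] N group_Mod[OF H M] rcoset_hom[OF H M h] _ x])
  fix n assume "n \<in> N"
  then show "M #>\<^bsub>H\<^esub> h n = \<one>\<^bsub>H Mod M\<^esub>"
    using rcoset_eq_one_iff[OF comm_group.axioms(2)[OF H] M] hN subgroup.mem_carrier[OF M] by blast
qed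

lemma induced_Mod_hom:
  assumes G: "comm_group G" and N: "subgroup N G" and H: "comm_group H" and M: "subgroup M H"
    and h: "h \<in> hom G H" and hN: "h ` N \<subseteq> M"
  shows "induced (\<lambda>x. M #>\<^bsub>H\<^esub> h x) \<in> hom (G Mod N) (H Mod M)"
proof (rule induced_hom[OF G N group_Mod[OF H M] rcoset_hom[OF H M h]])
  fix n assume "n \<in> N"
  then show "M #>\<^bsub>H\<^esub> h n = \<one>\<^bsub>H Mod M\<^esub>"
    using rcoset_eq_one_iff[OF comm_group.axioms(2)[OF H] M] hN subgroup.mem_carrier[OF M] by blast
qed

text \<open>This is the first isomorphism theorem, phrased for \<open>induced\<close>.\<close>

lemma induced_iso:
  assumes "group G" "group H" "f \<in> hom G H" "f ` carrier G = carrier H" "kernel G H f = N"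
  shows "induced f \<in> iso (G Mod N) H"
proof -
  interpret group_hom G H f
    using assms by (simp add: group_hom_def group_hom_axioms_def)
  have "induced f = (\<lambda>X. the_elem (f ` X))" by (simp add: fun_eq_iff induced_def)
  then show ?thesis using FactGroup_iso_set assms(4,5) by simp
qed

lemma induced_Mod_iso:
  assumes G: "comm_group G" and N: "subgroup N G" and H: "comm_group H" and M: "subgroup M H"
    and h: "h \<in> iso G H" and hN: "h ` N = M"
  shows "induced (\<lambda>x. M #>\<^bsub>H\<^esub> h x) \<in> iso (G Mod N) (H Mod M)"
proof (rule induced_iso[OF comm_group.axioms(2)[OF G] group_Mod[OF H M]])
  have hh: "h \<in> hom G H" and inj: "inj_on h (carrier G)" and surj: "h ` carrier G = carrier H"
    using h by (auto simp: iso_def bij_betw_def)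
  show "(\<lambda>x. M #>\<^bsub>H\<^esub> h x) \<in> hom G (H Mod M)"
    by (rule rcoset_hom[OF H M hh])
  show "(\<lambda>x. M #>\<^bsub>H\<^esub> h x) ` carrier G = carrier (H Mod M)"
    unfolding carrier_FactGroup surj[symmetric] by (simp add: image_image)
  \<comment> \<open>Some n in \<open>N\<close> has the same image as \<open>x\<close>, and
    \<open>h\<close> is injective.\<close>
  have "x \<in> N" if "x \<in> carrier G" "h x \<in> M" for x
    using that hN inj subgroup.subset[OF N] by (auto simp: inj_on_def)
  then show "kernel G (H Mod M) (\<lambda>x. M #>\<^bsub>H\<^esub> h x) = N"
    unfolding kernel_def
    using rcoset_eq_one_iff[OF comm_group.axioms(2)[OF H] M] hN hom_in_carrier[OF hh]
      subgroup.mem_carrier[OF N] by blast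
qed

lemma comm_group_subgroup:
  assumes G: "comm_group G" and "subgroup S G"
  shows "comm_group (G\<lparr>carrier := S\<rparr>)"
proof -
  have "group (G\<lparr>carrier := S\<rparr>)"
    using subgroup.subgroup_is_group assms comm_group.axioms(2) by blast
  then show ?thesis
    by (rule group.group_comm_groupI)
      (use assms in \<open>auto simp: comm_group.axioms comm_monoid.m_comm subgroup.mem_carrier\<close>)
qed

section \<open>Dual groups, chains and cochains\<close>

lemma dual_group_simps [simp]:
  "carrier (dual_group G) = hom G integer_group \<inter> extensional (carrier G)"
  "monoid.mult (dual_group G) = (\<lambda>f g. \<lambda>x\<in>carrier G. f x + g x)"
  "\<one>\<^bsub>dual_group G\<^esub> = (\<lambda>x\<in>carrier G. 0)"
  by (simp_all add: dual_group_def)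

lemma comm_group_dual_group:
  assumes "group G"
  shows "comm_group (dual_group G)"
proof (rule comm_groupI)
  interpret group G by fact
  show "x \<otimes>\<^bsub>dual_group G\<^esub> y \<in> carrier (dual_group G)"
    if "x \<in> carrier (dual_group G)" "y \<in> carrier (dual_group G)" for x y
    using that by (auto simp: hom_def)
  show "\<one>\<^bsub>dual_group G\<^esub> \<in> carrier (dual_group G)"
    by (auto simp: hom_def)
  show "\<one>\<^bsub>dual_group G\<^esub> \<otimes>\<^bsub>dual_group G\<^esub> x = x" if "x \<in> carrier (dual_group G)" for x
    using that by (auto simp: fun_eq_iff extensional_def)
  show "\<exists>y\<in>carrier (dual_group G). y \<otimes>\<^bsub>dual_group G\<^esub> x = \<one>\<^bsub>dual_group G\<^esub>"
    if "x \<in> carrier (dual_group G)" for x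
    \<comment> \<open>The inverse is the pointwise negative, restricted to the carrier so that it
      stays extensional.\<close>
    using that
    by (intro bexI[of _ "\<lambda>z\<in>carrier G. - x z"]) (auto simp: hom_def fun_eq_iff)
qed (auto simp: fun_eq_iff)

lemma comm_group_cochain_group: "comm_group (cochain_group S)"
  by (rule group.group_comm_groupI) (auto simp: fun_eq_iff)

lemma PiE_UNIV_eq_extensional [simp]: "(S \<rightarrow>\<^sub>E UNIV) = extensional S"
  by (auto simp: PiE_def)

text \<open>Chains with different supports can be compared termwise once their pairings are sums
  over one common finite set.\<close>

lemma pairing_superset:
  assumes "finite A" "Poly_Mapping.keys c \<subseteq> A"
  shows "pairing w c = (\<Sum>x\<in>A. Poly_Mapping.lookup c x * w x)"
  unfolding pairing_def
  by (rule sum.mono_neutral_left) (use assms in \<open>auto simp: in_keys_iff\<close>)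

lemma pairing_0 [simp]: "pairing w 0 = 0"
  by (simp add: pairing_def)

lemma pairing_frag_of [simp]: "pairing w (frag_of x) = w x"
  by (simp add: pairing_def)

lemma pairing_add: "pairing w (a + b) = pairing w a + pairing w b"
proof -
  let ?A = "Poly_Mapping.keys a \<union> Poly_Mapping.keys b"
  have "Poly_Mapping.keys (a + b) \<subseteq> ?A" by (rule keys_add)
  then show ?thesis
    by (simp add: pairing_superset[of ?A] lookup_add distrib_right sum.distrib)
qed

lemma pairing_diff: "pairing w (a - b) = pairing w a - pairing w b"
  using pairing_add[of w "a - b" b] by simp

lemma pairing_sum: "pairing w (\<Sum>i\<in>I. c i) = (\<Sum>i\<in>I. pairing w (c i))"
  by (induction I rule: infinite_finite_induct) (simp_all add: pairing_add)

lemma pairing_cong: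
  assumes "Poly_Mapping.keys c \<subseteq> S" "\<And>x. x \<in> S \<Longrightarrow> f x = g x"
  shows "pairing f c = pairing g c"
  unfolding pairing_def by (rule sum.cong) (use assms in auto)

text \<open>The product of cochains is restricted to \<open>S\<close>; the support condition keeps
  the pairing at points where that product is the pointwise sum.\<close>

lemma pairing_mult:
  assumes "Poly_Mapping.keys c \<subseteq> S"
  shows "pairing (f \<otimes>\<^bsub>cochain_group S\<^esub> g) c = pairing f c + pairing g c"
proof -
  have "pairing (f \<otimes>\<^bsub>cochain_group S\<^esub> g) c = pairing (\<lambda>x. f x + g x) c"
    by (rule pairing_cong[OF assms]) simp
  then show ?thesis by (simp add: pairing_def distrib_left sum.distrib)
qed

lemma pairing_char_fun:
  assumes "Poly_Mapping.keys a \<subseteq> S"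
  shows "pairing (char_fun S b) a = pairing (Poly_Mapping.lookup b) a"
  by (rule pairing_cong[OF assms]) (simp add: char_fun_def)

text \<open>Both sides are the sum of the products of coefficients over the union of the two
  supports.\<close>

lemma pairing_char_fun_commute:
  assumes "Poly_Mapping.keys a \<subseteq> S" "Poly_Mapping.keys b \<subseteq> S"
  shows "pairing (char_fun S a) b = pairing (char_fun S b) a"
  unfolding pairing_char_fun[OF assms(1)] pairing_char_fun[OF assms(2)]
  by (simp add: pairing_superset[of "Poly_Mapping.keys a \<union> Poly_Mapping.keys b"] mult.commute)

lemma char_fun_hom: "char_fun S \<in> hom (chain_group S) (cochain_group S)"
  by (rule homI) (auto simp: char_fun_def lookup_add fun_eq_iff)

lemma inj_on_char_fun: "inj_on (char_fun S) (carrier (chain_group S))"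
proof (rule inj_onI)
  fix a b assume ab: "a \<in> carrier (chain_group S)" "b \<in> carrier (chain_group S)"
    "char_fun S a = char_fun S b"
  show "a = b"
  proof (rule poly_mapping_eqI)
    fix x
    show "Poly_Mapping.lookup a x = Poly_Mapping.lookup b x"
    proof (cases "x \<in> S")
      case True
      then show ?thesis using fun_cong[OF ab(3), of x] by (simp add: char_fun_def)
    next
      case False
      then have "x \<notin> Poly_Mapping.keys a" "x \<notin> Poly_Mapping.keys b" using ab(1,2) by auto
      then show ?thesis by (simp add: in_keys_iff)
    qed
  qed
qed

text \<open>On a finite set every cochain has finite support, so it comes from the chain with the
  same coefficients.\<close>

lemma char_fun_iso:
  assumes "finite S"
  shows "char_fun S \<in> iso (chain_group S) (cochain_group S)"
proof -
  have "w \<in> char_fun S ` carrier (chain_group S)" if w: "w \<in> extensional S" for w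
  proof
    let ?c = "\<Sum>x\<in>S. Poly_Mapping.single x (w x)"
    have lk: "Poly_Mapping.lookup ?c x = (if x \<in> S then w x else 0)" for x
      using assms by (simp add: lookup_sum lookup_single when_def)
    show "w = char_fun S ?c"
      using w by (auto simp: char_fun_def lk fun_eq_iff extensional_def)
    show "?c \<in> carrier (chain_group S)"
      by (auto simp: in_keys_iff lk split: if_splits)
  qed
  then have "char_fun S ` carrier (chain_group S) = extensional S"
    by (auto simp: char_fun_def)
  then show ?thesis
    using char_fun_hom[of S] inj_on_char_fun[of S] by (simp add: iso_def bij_betw_def)
qed

text \<open>Generators and differences exhaust a free abelian group, so an identity between additive
  maps need only be checked on single vertices or edges.\<close>

lemmas chain_induct = free_Abelian_group_induct[consumes 1, case_names zero diff one]

section \<open>Boundary and coboundary operators\<close>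

context locally_finite_graph
begin

abbreviation "C0 \<equiv> chain_group (verts \<Gamma>)"
abbreviation "C1 \<equiv> chain_group (arcs \<Gamma>)"
abbreviation "K0 \<equiv> cochain_group (verts \<Gamma>)"
abbreviation "K1 \<equiv> cochain_group (arcs \<Gamma>)"

lemma bd_add: "bd \<Gamma> (a + b) = bd \<Gamma> a + bd \<Gamma> b"
  and bd_diff: "bd \<Gamma> (a - b) = bd \<Gamma> a - bd \<Gamma> b"
  and bd_0 [simp]: "bd \<Gamma> 0 = 0"
  and bd_frag_of [simp]: "bd \<Gamma> (frag_of e) = frag_of (head \<Gamma> e) - frag_of (tail \<Gamma> e)"
  by (simp_all add: bd_def frag_extend_add frag_extend_diff)

lemma bd_adj_add: "bd_adj \<Gamma> (a + b) = bd_adj \<Gamma> a + bd_adj \<Gamma> b"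
  and bd_adj_diff: "bd_adj \<Gamma> (a - b) = bd_adj \<Gamma> a - bd_adj \<Gamma> b"
  and bd_adj_0 [simp]: "bd_adj \<Gamma> 0 = 0"
  and bd_adj_frag_of [simp]: "bd_adj \<Gamma> (frag_of v) =
    (\<Sum>e\<in>in_arcs \<Gamma> v. frag_of e) - (\<Sum>e\<in>out_arcs \<Gamma> v. frag_of e)"
  by (simp_all add: bd_adj_def frag_extend_add frag_extend_diff)

lemma keys_bd:
  assumes "Poly_Mapping.keys c \<subseteq> arcs \<Gamma>"
  shows "Poly_Mapping.keys (bd \<Gamma> c) \<subseteq> verts \<Gamma>"
  using assms
proof (induction rule: chain_induct)
  case (diff a b)
  then show ?case unfolding bd_diff using keys_diff[of "bd \<Gamma> a" "bd \<Gamma> b"] by blast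
next
  case (one e)
  then show ?case
    using keys_diff[of "frag_of (head \<Gamma> e)" "frag_of (tail \<Gamma> e)"] by auto
qed auto

lemma keys_bd_adj:
  assumes "Poly_Mapping.keys c \<subseteq> verts \<Gamma>"
  shows "Poly_Mapping.keys (bd_adj \<Gamma> c) \<subseteq> arcs \<Gamma>"
  using assms
proof (induction rule: chain_induct)
  case (diff a b)
  then show ?case unfolding bd_adj_diff using keys_diff[of "bd_adj \<Gamma> a" "bd_adj \<Gamma> b"] by blast
next
  case (one v)
  have "Poly_Mapping.keys (\<Sum>e\<in>in_arcs \<Gamma> v. frag_of e) \<subseteq> arcs \<Gamma>"
    "Poly_Mapping.keys (\<Sum>e\<in>out_arcs \<Gamma> v. frag_of e) \<subseteq> arcs \<Gamma>"
    using keys_sum[of frag_of "in_arcs \<Gamma> v"] keys_sum[of frag_of "out_arcs \<Gamma> v"] by auto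
  then show ?case
    unfolding bd_adj_frag_of
    using keys_diff[of "\<Sum>e\<in>in_arcs \<Gamma> v. frag_of e" "\<Sum>e\<in>out_arcs \<Gamma> v. frag_of e"] by blast
qed auto

lemma bd_hom: "bd \<Gamma> \<in> hom C1 C0"
  by (rule homI) (simp_all add: keys_bd bd_add)

lemma laplace0_hom: "laplace0 \<Gamma> \<in> hom C0 C0"
  by (rule homI) (simp_all add: laplace0_def keys_bd keys_bd_adj bd_add bd_adj_add)

lemma cobd_hom: "cobd \<Gamma> \<in> hom K0 K1"
  by (rule homI) (auto simp: cobd_def fun_eq_iff)

lemma cobd_adj_hom: "cobd_adj \<Gamma> \<in> hom K1 K0"
proof (rule homI)
  fix x y
  show "cobd_adj \<Gamma> (x \<otimes>\<^bsub>K1\<^esub> y) = cobd_adj \<Gamma> x \<otimes>\<^bsub>K0\<^esub> cobd_adj \<Gamma> y"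
    by (auto simp: cobd_adj_def fun_eq_iff sum.distrib)
qed (auto simp: cobd_adj_def)

lemma box0_hom: "box0 \<Gamma> \<in> hom K0 K0"
  unfolding box0_def by (rule Group.hom_compose[OF cobd_hom cobd_adj_hom])

text \<open>On a single edge both sides record +1 at the head and -1 at the tail, cancelling for a
  loop. Local finiteness matters because a sum over an infinite set defaults to 0.\<close>

lemma cobd_adj_iota1:
  assumes "Poly_Mapping.keys c \<subseteq> arcs \<Gamma>"
  shows "cobd_adj \<Gamma> (iota1 \<Gamma> c) = iota0 \<Gamma> (bd \<Gamma> c)"
proof -
  have "(\<Sum>e\<in>in_arcs \<Gamma> v. Poly_Mapping.lookup c e) - (\<Sum>e\<in>out_arcs \<Gamma> v. Poly_Mapping.lookup c e)
      = Poly_Mapping.lookup (bd \<Gamma> c) v" if v: "v \<in> verts \<Gamma>" for v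
    using assms
  proof (induction rule: chain_induct)
    case (diff a b)
    then show ?case by (simp add: bd_diff lookup_minus sum_subtractf)
  next
    case (one e)
    then show ?case
      using v finite_in_arcs_at finite_out_arcs_at by (auto simp: lookup_minus)
  qed simp
  then show ?thesis
    by (auto simp: cobd_adj_def iota0_def iota1_def char_fun_def fun_eq_iff)
qed

text \<open>For a single vertex v, both sides at an edge are +1 if v is its head, -1 if v is its
  tail, and 0 for a loop or an edge away from v.\<close>

lemma cobd_iota0:
  assumes "Poly_Mapping.keys c \<subseteq> verts \<Gamma>"
  shows "cobd \<Gamma> (iota0 \<Gamma> c) = iota1 \<Gamma> (bd_adj \<Gamma> c)"
proof -
  have "Poly_Mapping.lookup c (head \<Gamma> e) - Poly_Mapping.lookup c (tail \<Gamma> e)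
      = Poly_Mapping.lookup (bd_adj \<Gamma> c) e" if e: "e \<in> arcs \<Gamma>" for e
    using assms
  proof (induction rule: chain_induct)
    case (diff a b)
    then show ?case by (simp add: bd_adj_diff lookup_minus)
  next
    case (one v)
    then show ?case
      using e finite_in_arcs_at finite_out_arcs_at by (auto simp: lookup_minus lookup_sum)
  qed simp
  then show ?thesis
    by (auto simp: cobd_def iota0_def iota1_def char_fun_def fun_eq_iff)
qed

lemma box0_iota0:
  assumes "Poly_Mapping.keys c \<subseteq> verts \<Gamma>"
  shows "box0 \<Gamma> (iota0 \<Gamma> c) = iota0 \<Gamma> (laplace0 \<Gamma> c)"
  using assms by (simp add: box0_def laplace0_def cobd_iota0 cobd_adj_iota1 keys_bd_adj)

text \<open>On a generator this unfolds to the definition of \<open>cobd_adj\<close>. It makes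
  harmonic cochains vanish on the image of \<open>bd_adj\<close>, as needed for
  \<open>AJ\<close>.\<close>

lemma pairing_bd_adj:
  assumes "Poly_Mapping.keys c \<subseteq> verts \<Gamma>"
  shows "pairing w (bd_adj \<Gamma> c) = pairing (cobd_adj \<Gamma> w) c"
  using assms
proof (induction rule: chain_induct)
  case (one v)
  then show ?case by (simp add: pairing_diff pairing_sum cobd_adj_def)
qed (simp_all add: bd_adj_diff pairing_diff)

text \<open>A discrete Stokes formula: coboundaries vanish on cycles, so the pairing with cycles
  descends to \<open>H_upper1 \<Gamma>\<close>.\<close>

lemma pairing_cobd:
  assumes "Poly_Mapping.keys c \<subseteq> arcs \<Gamma>"
  shows "pairing (cobd \<Gamma> f) c = pairing f (bd \<Gamma> c)"
  using assms
proof (induction rule: chain_induct)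
  case (one v)
  then show ?case by (simp add: pairing_diff cobd_def)
qed (simp_all add: bd_diff pairing_diff)

section \<open>Subgroups and quotients determined by the operators\<close>

lemma group_hom_ops:
  "group_hom C1 C0 (bd \<Gamma>)" "group_hom C0 C0 (laplace0 \<Gamma>)"
  "group_hom K0 K1 (cobd \<Gamma>)" "group_hom K1 K0 (cobd_adj \<Gamma>)" "group_hom K0 K0 (box0 \<Gamma>)"
  by (simp_all add: group_hom_def group_hom_axioms_def bd_hom laplace0_hom cobd_hom cobd_adj_hom
      box0_hom)

lemma subgroup_im_laplace0: "subgroup (im_laplace0 \<Gamma>) C0"
  unfolding im_laplace0_def by (rule group_hom.img_is_subgroup) (rule group_hom_ops)

lemma subgroup_im_box0: "subgroup (im_box0 \<Gamma>) K0"
  unfolding im_box0_def by (rule group_hom.img_is_subgroup) (rule group_hom_ops)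

lemma subgroup_im_cobd: "subgroup (im_cobd \<Gamma>) K1"
  unfolding im_cobd_def by (rule group_hom.img_is_subgroup) (rule group_hom_ops)

lemma subgroup_im_cobd_adj: "subgroup (cobd_adj \<Gamma> ` carrier K1) K0"
  by (rule group_hom.img_is_subgroup) (rule group_hom_ops)

lemma im_box0_subset: "im_box0 \<Gamma> \<subseteq> cobd_adj \<Gamma> ` carrier K1"
  using hom_in_carrier[OF cobd_hom] by (auto simp: im_box0_def box0_def)

lemma comm_group_cochain_group_im: "comm_group (cochain_group_im \<Gamma>)"
  unfolding cochain_group_im_def
  by (rule comm_group_subgroup[OF comm_group_cochain_group subgroup_im_cobd_adj])

lemma subgroup_im_box0_im: "subgroup (im_box0 \<Gamma>) (cochain_group_im \<Gamma>)"
  unfolding cochain_group_im_def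
  using subgroup_im_box0 subgroup_im_cobd_adj im_box0_subset
  by (intro group.subgroup_incl) auto

text \<open>Viewing the degree as the pairing with the constant 1 makes the additivity rules for
  \<open>pairing\<close> available for it.\<close>

lemma degree_eq_pairing:
  "(\<Sum>v\<in>Poly_Mapping.keys D. Poly_Mapping.lookup D v) = pairing (\<lambda>_. 1) D"
  by (simp add: pairing_def)

lemma carrier_chain_group_deg0:
  "carrier (chain_group_deg0 \<Gamma>) = {D. Poly_Mapping.keys D \<subseteq> verts \<Gamma> \<and> pairing (\<lambda>_. 1) D = 0}"
  by (auto simp: chain_group_deg0_def degree_eq_pairing)

lemma degree_bd:
  assumes "Poly_Mapping.keys c \<subseteq> arcs \<Gamma>"
  shows "pairing (\<lambda>_. 1) (bd \<Gamma> c) = 0"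
  using assms by (induction rule: chain_induct) (simp_all add: bd_diff pairing_diff)

lemma comm_group_H_lower1: "comm_group (H_lower1 \<Gamma>)"
  unfolding H_lower1_def
  by (intro comm_group_subgroup abelian_free_Abelian_group group_hom.subgroup_kernel group_hom_ops)

lemma comm_group_Harm1: "comm_group (Harm1 \<Gamma>)"
  unfolding Harm1_def
  by (intro comm_group_subgroup comm_group_cochain_group group_hom.subgroup_kernel group_hom_ops)

lemma comm_group_H_upper1: "comm_group (H_upper1 \<Gamma>)"
  unfolding H_upper1_def
  by (rule comm_group.abelian_FactGroup[OF comm_group_cochain_group subgroup_im_cobd])

lemma carrier_H_lower1:
  "carrier (H_lower1 \<Gamma>) = {c. Poly_Mapping.keys c \<subseteq> arcs \<Gamma> \<and> bd \<Gamma> c = 0}"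
  by (simp add: H_lower1_def kernel_def)

lemma mult_H_lower1 [simp]: "a \<otimes>\<^bsub>H_lower1 \<Gamma>\<^esub> b = a + b"
  by (simp add: H_lower1_def)

lemma carrier_Harm1:
  "carrier (Harm1 \<Gamma>) = {w \<in> extensional (arcs \<Gamma>). cobd_adj \<Gamma> w = (\<lambda>v\<in>verts \<Gamma>. 0)}"
  by (simp add: Harm1_def kernel_def)

lemma mult_Harm1 [simp]: "monoid.mult (Harm1 \<Gamma>) = monoid.mult K1"
  by (simp add: Harm1_def)

lemma iota1_Harm1:
  assumes "c \<in> carrier (H_lower1 \<Gamma>)"
  shows "iota1 \<Gamma> c \<in> carrier (Harm1 \<Gamma>)"
  using assms
  by (auto simp: carrier_H_lower1 carrier_Harm1 cobd_adj_iota1)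
    (auto simp: iota1_def iota0_def char_fun_def fun_eq_iff)

text \<open>The domain is all chains and not just cycles, because \<open>AJ\<close> evaluates at
  chains with nonzero boundary; the cycles alone give \<open>im_alpha\<close>.\<close>

lemma eval_harm_hom: "eval_harm \<Gamma> \<in> hom C1 (dual_group (Harm1 \<Gamma>))"
proof (rule homI)
  interpret Harm: comm_group "Harm1 \<Gamma>" by (rule comm_group_Harm1)
  fix c d assume c: "c \<in> carrier C1"
  show "eval_harm \<Gamma> c \<in> carrier (dual_group (Harm1 \<Gamma>))"
    using c Harm.m_closed by (auto simp: eval_harm_def hom_def pairing_mult simp del: mult_product_group)
  show "eval_harm \<Gamma> (c \<otimes>\<^bsub>C1\<^esub> d) = eval_harm \<Gamma> c \<otimes>\<^bsub>dual_group (Harm1 \<Gamma>)\<^esub> eval_harm \<Gamma> d"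
    by (auto simp: eval_harm_def pairing_add fun_eq_iff)
qed

lemma comm_group_dual_Harm1: "comm_group (dual_group (Harm1 \<Gamma>))"
  by (rule comm_group_dual_group[OF comm_group.axioms(2)[OF comm_group_Harm1]])

lemma subgroup_H_lower1: "subgroup (carrier (H_lower1 \<Gamma>)) C1"
  using group_hom.subgroup_kernel[OF group_hom_ops(1)] by (simp add: H_lower1_def)

lemma subgroup_im_alpha: "subgroup (im_alpha \<Gamma>) (dual_group (Harm1 \<Gamma>))"
  unfolding im_alpha_def
proof (rule group_hom.subgroup_img_is_subgroup[OF _ subgroup_H_lower1])
  show "group_hom C1 (dual_group (Harm1 \<Gamma>)) (eval_harm \<Gamma>)"
    using comm_group_dual_Harm1
    by (simp add: group_hom_def group_hom_axioms_def eval_harm_hom comm_group.axioms)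
qed

lemma subgroup_Harm1: "subgroup (carrier (Harm1 \<Gamma>)) K1"
  using group_hom.subgroup_kernel[OF group_hom_ops(4)] by (simp add: Harm1_def)

lemma rcoset_im_cobd_hom: "(\<lambda>w. im_cobd \<Gamma> #>\<^bsub>K1\<^esub> w) \<in> hom K1 (H_upper1 \<Gamma>)"
  using rcoset_hom[OF comm_group_cochain_group subgroup_im_cobd, of "\<lambda>x. x" K1]
  by (simp add: H_upper1_def hom_def)

lemma subgroup_im_beta: "subgroup (im_beta \<Gamma>) (H_upper1 \<Gamma>)"
  unfolding im_beta_def
proof (rule group_hom.subgroup_img_is_subgroup[OF _ subgroup_Harm1])
  show "group_hom K1 (H_upper1 \<Gamma>) (\<lambda>w. im_cobd \<Gamma> #>\<^bsub>K1\<^esub> w)"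
    using comm_group_H_upper1
    by (simp add: group_hom_def group_hom_axioms_def rcoset_im_cobd_hom comm_group.axioms)
qed

text \<open>Adjointness moves \<open>bd_adj\<close> onto the harmonic cochain, where it becomes
  \<open>cobd_adj\<close> and gives zero.\<close>

lemma eval_harm_bd_adj:
  assumes "Poly_Mapping.keys c \<subseteq> verts \<Gamma>"
  shows "eval_harm \<Gamma> (bd_adj \<Gamma> c) = \<one>\<^bsub>dual_group (Harm1 \<Gamma>)\<^esub>"
proof -
  have "pairing (cobd_adj \<Gamma> w) c = 0" if "w \<in> carrier (Harm1 \<Gamma>)" for w
    using that assms by (auto simp: carrier_Harm1 pairing_def intro!: sum.neutral)
  then show ?thesis
    using assms by (auto simp: eval_harm_def pairing_bd_adj fun_eq_iff)
qed

section \<open>The map on class groups induced by \<open>iota0\<close>\<close>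

lemma iota0_im_laplace0: "iota0 \<Gamma> ` im_laplace0 \<Gamma> = box0 \<Gamma> ` iota0 \<Gamma> ` carrier C0"
  unfolding im_laplace0_def image_image
  by (rule image_cong) (simp_all add: box0_iota0)

text \<open>The left side is \<open>box0\<close> applied to the finitely supported cochains only; on
  a finite graph these are all cochains, and the inclusion becomes an equality.\<close>

lemma iota0_im_laplace0_subset: "iota0 \<Gamma> ` im_laplace0 \<Gamma> \<subseteq> im_box0 \<Gamma>"
  unfolding iota0_im_laplace0 im_box0_def
  by (auto simp: iota0_def char_fun_def)

lemma iota0_hom: "iota0 \<Gamma> \<in> hom C0 K0"
  unfolding iota0_def by (rule char_fun_hom)

lemma iota1_in_K1: "iota1 \<Gamma> c \<in> carrier K1"
  by (simp add: iota1_def char_fun_def)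

lemmas iota_Cl_hom =
  induced_Mod_hom[OF abelian_free_Abelian_group subgroup_im_laplace0 comm_group_cochain_group
    subgroup_im_box0 iota0_hom iota0_im_laplace0_subset, folded Cl_def Clhat_def iota_Cl_def]

lemmas iota_Cl_rcoset =
  induced_Mod_rcoset[OF abelian_free_Abelian_group subgroup_im_laplace0 comm_group_cochain_group
    subgroup_im_box0 iota0_hom iota0_im_laplace0_subset, folded iota_Cl_def]

text \<open>A right coset depends only on the multiplication, which \<open>cochain_group_im\<close>
  shares with the full cochain group, so the two maps coincide as functions.\<close>

lemma iota_Cl0_eq_iota_Cl: "iota_Cl0 \<Gamma> = iota_Cl \<Gamma>"
  by (simp add: iota_Cl0_def iota_Cl_def cochain_group_im_def r_coset_def)

section \<open>Duals of cycles and of harmonic cochains\<close>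

lemma comm_group_dual_H_lower1: "comm_group (dual_group (H_lower1 \<Gamma>))"
  by (rule comm_group_dual_group[OF comm_group.axioms(2)[OF comm_group_H_lower1]])

text \<open>This is the function underlying \<open>H_upper1_to_dual\<close> before passage to
  cosets; its image and kernel decide whether that map is an isomorphism.\<close>

abbreviation cycle_pairing :: "('e \<Rightarrow> int) \<Rightarrow> ('e \<Rightarrow>\<^sub>0 int) \<Rightarrow> int" where
  "cycle_pairing \<omega> \<equiv> \<lambda>\<gamma>\<in>carrier (H_lower1 \<Gamma>). pairing \<omega> \<gamma>"

lemma cycle_pairing_hom: "cycle_pairing \<in> hom K1 (dual_group (H_lower1 \<Gamma>))"
proof (rule homI)
  interpret H: comm_group "H_lower1 \<Gamma>" by (rule comm_group_H_lower1)
  fix w v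
  have "a + b \<in> carrier (H_lower1 \<Gamma>)"
    if "a \<in> carrier (H_lower1 \<Gamma>)" "b \<in> carrier (H_lower1 \<Gamma>)" for a b
    using H.m_closed[OF that] by simp
  then show "cycle_pairing w \<in> carrier (dual_group (H_lower1 \<Gamma>))"
    by (auto simp: hom_def pairing_add)
  show "cycle_pairing (w \<otimes>\<^bsub>K1\<^esub> v)
      = cycle_pairing w \<otimes>\<^bsub>dual_group (H_lower1 \<Gamma>)\<^esub> cycle_pairing v"
    by (auto simp: fun_eq_iff carrier_H_lower1 pairing_mult simp del: mult_product_group)
qed

lemma iota1_hom: "iota1 \<Gamma> \<in> hom (H_lower1 \<Gamma>) (Harm1 \<Gamma>)"
  by (rule homI, rule iota1_Harm1) (auto simp: iota1_def char_fun_def lookup_add fun_eq_iff)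

lemma iota_transpose_hom:
  "iota_transpose \<Gamma> \<in> hom (dual_group (Harm1 \<Gamma>)) (dual_group (H_lower1 \<Gamma>))"
proof (rule homI)
  interpret H: comm_group "H_lower1 \<Gamma>" by (rule comm_group_H_lower1)
  fix f g assume f: "f \<in> carrier (dual_group (Harm1 \<Gamma>))"
  then have "f \<circ> iota1 \<Gamma> \<in> hom (H_lower1 \<Gamma>) integer_group"
    by (intro Group.hom_compose[OF iota1_hom]) simp
  then show "iota_transpose \<Gamma> f \<in> carrier (dual_group (H_lower1 \<Gamma>))"
    using H.m_closed by (auto simp: iota_transpose_def hom_def)
  show "iota_transpose \<Gamma> (f \<otimes>\<^bsub>dual_group (Harm1 \<Gamma>)\<^esub> g)
      = iota_transpose \<Gamma> f \<otimes>\<^bsub>dual_group (H_lower1 \<Gamma>)\<^esub> iota_transpose \<Gamma> g"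
    by (auto simp: iota_transpose_def fun_eq_iff iota1_Harm1)
qed

text \<open>By symmetry of the pairing of finite chains, evaluating
  \<open>iota1 \<Gamma> \<gamma>\<close> on \<open>c\<close> is the same as evaluating
  \<open>iota1 \<Gamma> c\<close> on \<open>\<gamma>\<close>.\<close>

lemma iota_transpose_eval_harm:
  assumes "Poly_Mapping.keys c \<subseteq> arcs \<Gamma>"
  shows "iota_transpose \<Gamma> (eval_harm \<Gamma> c) = cycle_pairing (iota1 \<Gamma> c)"
  using assms pairing_char_fun_commute[of c "arcs \<Gamma>"]
  by (auto simp: iota_transpose_def eval_harm_def fun_eq_iff iota1_Harm1)
    (simp add: iota1_def carrier_H_lower1)

text \<open>The inner \<open>induced\<close> is constant on cosets of \<open>im_cobd\<close> because
  \<open>cobd_adj\<close> after \<open>cobd\<close> is \<open>box0\<close>; the outer one is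
  constant on cosets of \<open>im_beta\<close> because \<open>cobd_adj\<close> kills harmonic
  cochains.\<close>

lemma chi_rcoset:
  assumes w: "w \<in> carrier K1"
  shows "chi \<Gamma> (im_beta \<Gamma> #>\<^bsub>H_upper1 \<Gamma>\<^esub> (im_cobd \<Gamma> #>\<^bsub>K1\<^esub> w))
    = im_box0 \<Gamma> #>\<^bsub>cochain_group_im \<Gamma>\<^esub> cobd_adj \<Gamma> w"
proof -
  let ?g = "\<lambda>\<omega>. im_box0 \<Gamma> #>\<^bsub>cochain_group_im \<Gamma>\<^esub> cobd_adj \<Gamma> \<omega>"
  have hom: "cobd_adj \<Gamma> \<in> hom K1 (cochain_group_im \<Gamma>)"
    using cobd_adj_hom by (auto simp: hom_def cochain_group_im_def)
  have sub: "cobd_adj \<Gamma> ` im_cobd \<Gamma> \<subseteq> im_box0 \<Gamma>"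
    by (auto simp: im_cobd_def im_box0_def box0_def)
  note inner = induced_Mod_rcoset[OF comm_group_cochain_group subgroup_im_cobd
      comm_group_cochain_group_im subgroup_im_box0_im hom sub]
  note inner_hom = induced_Mod_hom[OF comm_group_cochain_group subgroup_im_cobd
      comm_group_cochain_group_im subgroup_im_box0_im hom sub, folded H_upper1_def]
  have grp: "group (cochain_group_im \<Gamma> Mod im_box0 \<Gamma>)"
    by (rule group_Mod[OF comm_group_cochain_group_im subgroup_im_box0_im])
  have triv: "induced ?g n = \<one>\<^bsub>cochain_group_im \<Gamma> Mod im_box0 \<Gamma>\<^esub>" if n: "n \<in> im_beta \<Gamma>" for n
  proof -
    obtain h where h: "h \<in> carrier (Harm1 \<Gamma>)" "n = im_cobd \<Gamma> #>\<^bsub>K1\<^esub> h"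
      using n unfolding im_beta_def by blast
    then have hK: "h \<in> carrier K1" and z: "cobd_adj \<Gamma> h = \<one>\<^bsub>K0\<^esub>"
      by (auto simp: carrier_Harm1)
    have "cobd_adj \<Gamma> h \<in> im_box0 \<Gamma>"
      unfolding z by (rule subgroup.one_closed[OF subgroup_im_box0])
    then show ?thesis
      unfolding h(2) inner[OF hK]
      using rcoset_eq_one_iff[OF comm_group.axioms(2)[OF comm_group_cochain_group_im]
          subgroup_im_box0_im hom_in_carrier[OF hom hK]] by simp
  qed
  have "chi \<Gamma> (im_beta \<Gamma> #>\<^bsub>H_upper1 \<Gamma>\<^esub> (im_cobd \<Gamma> #>\<^bsub>K1\<^esub> w))
      = induced ?g (im_cobd \<Gamma> #>\<^bsub>K1\<^esub> w)"
    unfolding chi_def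
    by (rule induced_rcoset[OF comm_group.axioms(2)[OF comm_group_H_upper1] subgroup_im_beta grp
          inner_hom triv hom_in_carrier[OF rcoset_im_cobd_hom w]])
  then show ?thesis unfolding inner[OF w] .
qed

end

section \<open>Connected graphs\<close>

locale connected_locally_finite_graph = locally_finite_graph \<Gamma>
  for \<Gamma> :: "('v, 'e) pre_digraph" +
  assumes connected: "Digraph_Component.connected \<Gamma>"
begin

text \<open>Follow a walk in the symmetrised graph, adding each edge traversed forwards and
  subtracting each edge traversed backwards; the boundary telescopes.\<close>

lemma exists_chain_between:
  assumes "u \<in> verts \<Gamma>" "v \<in> verts \<Gamma>"
  shows "\<exists>c. Poly_Mapping.keys c \<subseteq> arcs \<Gamma> \<and> bd \<Gamma> c = frag_of v - frag_of u"
proof -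
  have "u \<rightarrow>\<^sup>*\<^bsub>with_proj (mk_symmetric \<Gamma>)\<^esub> v"
    using connected assms by (auto simp: connected_def strongly_connected_def)
  then show ?thesis
    unfolding reachable_def
  proof (induction rule: rtrancl_on_induct)
    case base
    show ?case by (rule exI[of _ 0]) simp
  next
    case (step x y)
    then obtain c where c: "Poly_Mapping.keys c \<subseteq> arcs \<Gamma>" "bd \<Gamma> c = frag_of x - frag_of u"
      by blast
    from step(2) obtain e where e: "e \<in> arcs \<Gamma>"
      "x = tail \<Gamma> e \<and> y = head \<Gamma> e \<or> x = head \<Gamma> e \<and> y = tail \<Gamma> e"
      by (auto simp: parcs_mk_symmetric)
    then have ke: "Poly_Mapping.keys (frag_of e) \<subseteq> arcs \<Gamma>" by simp
    from e(2) show ?case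
    proof
      assume "x = tail \<Gamma> e \<and> y = head \<Gamma> e"
      then show ?thesis
        using c ke keys_add[of c "frag_of e"]
        by (intro exI[of _ "c + frag_of e"] conjI) (blast, simp add: bd_add)
    next
      assume "x = head \<Gamma> e \<and> y = tail \<Gamma> e"
      then show ?thesis
        using c ke keys_diff[of c "frag_of e"]
        by (intro exI[of _ "c - frag_of e"] conjI) (blast, simp add: bd_diff)
    qed
  qed
qed

text \<open>
  Choosing a chain from a root to every vertex gives a homomorphism \<open>lift\<close> that sections \<open>bd\<close> on
  degree zero, so \<open>c - lift (bd \<Gamma> c)\<close> projects the chains onto the cycles.
\<close>

definition root :: 'v where
  "root = (SOME v. v \<in> verts \<Gamma>)"

definition path_chain :: "'v \<Rightarrow> 'e \<Rightarrow>\<^sub>0 int" where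
  "path_chain v = (SOME c. Poly_Mapping.keys c \<subseteq> arcs \<Gamma> \<and> bd \<Gamma> c = frag_of v - frag_of root)"

definition lift :: "('v \<Rightarrow>\<^sub>0 int) \<Rightarrow> 'e \<Rightarrow>\<^sub>0 int" where
  "lift = frag_extend path_chain"

lemma root_in_verts: "root \<in> verts \<Gamma>"
  unfolding root_def using verts_nonempty by (simp add: some_in_eq)

lemma path_chain:
  assumes "v \<in> verts \<Gamma>"
  shows "Poly_Mapping.keys (path_chain v) \<subseteq> arcs \<Gamma>"
    and "bd \<Gamma> (path_chain v) = frag_of v - frag_of root"
  using someI_ex[OF exists_chain_between[OF root_in_verts assms]]
  unfolding path_chain_def by blast+

lemma lift_diff: "lift (a - b) = lift a - lift b"
  and lift_0 [simp]: "lift 0 = 0"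
  and lift_frag_of [simp]: "lift (frag_of v) = path_chain v"
  by (simp_all add: lift_def frag_extend_diff)

lemma keys_lift:
  assumes "Poly_Mapping.keys D \<subseteq> verts \<Gamma>"
  shows "Poly_Mapping.keys (lift D) \<subseteq> arcs \<Gamma>"
  using assms
proof (induction rule: chain_induct)
  case (diff a b)
  then show ?case unfolding lift_diff using keys_diff[of "lift a" "lift b"] by blast
qed (simp_all add: path_chain)

text \<open>Each vertex of \<open>D\<close>, counted with its coefficient, leaves one copy of
  \<open>root\<close> behind, so the total defect is the degree.\<close>

lemma bd_lift:
  assumes "Poly_Mapping.keys D \<subseteq> verts \<Gamma>"
  shows "bd \<Gamma> (lift D) = D - frag_cmul (pairing (\<lambda>_. 1) D) (frag_of root)"
  using assms
  by (induction rule: chain_induct)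
    (simp_all add: lift_diff bd_diff pairing_diff path_chain frag_cmul_diff_distrib)

text \<open>A boundary has degree zero, so the root term in \<open>bd_lift\<close> disappears and
  the two boundaries cancel.\<close>

lemma cycle_part:
  assumes "Poly_Mapping.keys c \<subseteq> arcs \<Gamma>"
  shows "c - lift (bd \<Gamma> c) \<in> carrier (H_lower1 \<Gamma>)"
  using assms keys_diff[of c "lift (bd \<Gamma> c)"] keys_lift[OF keys_bd[OF assms]]
  by (auto simp: carrier_H_lower1 bd_diff bd_lift keys_bd degree_bd)

section \<open>Degree-zero divisors as boundaries, and their class group\<close>

lemma im_bd: "bd \<Gamma> ` carrier C1 = carrier (chain_group_deg0 \<Gamma>)"
proof
  show "bd \<Gamma> ` carrier C1 \<subseteq> carrier (chain_group_deg0 \<Gamma>)"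
    by (auto simp: carrier_chain_group_deg0 degree_bd dest: subsetD[OF keys_bd])
  show "carrier (chain_group_deg0 \<Gamma>) \<subseteq> bd \<Gamma> ` carrier C1"
  proof
    fix D assume "D \<in> carrier (chain_group_deg0 \<Gamma>)"
    then have "D = bd \<Gamma> (lift D)" "lift D \<in> carrier C1"
      by (simp_all add: carrier_chain_group_deg0 bd_lift keys_lift)
    then show "D \<in> bd \<Gamma> ` carrier C1" by blast
  qed
qed

lemma chain_group_deg0_eq: "chain_group_deg0 \<Gamma> = C0\<lparr>carrier := bd \<Gamma> ` carrier C1\<rparr>"
  unfolding im_bd by (simp add: chain_group_deg0_def)

lemma subgroup_im_bd: "subgroup (bd \<Gamma> ` carrier C1) C0"
  by (rule group_hom.img_is_subgroup) (rule group_hom_ops)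

lemma comm_group_chain_group_deg0: "comm_group (chain_group_deg0 \<Gamma>)"
  unfolding chain_group_deg0_eq
  by (rule comm_group_subgroup[OF abelian_free_Abelian_group subgroup_im_bd])

lemma subgroup_im_laplace0_deg0: "subgroup (im_laplace0 \<Gamma>) (chain_group_deg0 \<Gamma>)"
  unfolding chain_group_deg0_eq
proof (rule group.subgroup_incl[OF _ subgroup_im_laplace0 subgroup_im_bd])
  show "im_laplace0 \<Gamma> \<subseteq> bd \<Gamma> ` carrier C1"
    by (auto simp: im_laplace0_def laplace0_def intro!: imageI dest: subsetD[OF keys_bd_adj])
qed simp

text \<open>This places the image inside that of \<open>cobd_adj\<close>, and gives all of it as
  soon as \<open>iota1\<close> is onto.\<close>

lemma iota0_carrier_deg0:
  "iota0 \<Gamma> ` carrier (chain_group_deg0 \<Gamma>) = cobd_adj \<Gamma> ` iota1 \<Gamma> ` carrier C1"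
  unfolding im_bd[symmetric] image_image
  by (rule image_cong) (simp_all add: cobd_adj_iota1)

lemma iota0_hom_deg0: "iota0 \<Gamma> \<in> hom (chain_group_deg0 \<Gamma>) (cochain_group_im \<Gamma>)"
proof -
  have "iota0 \<Gamma> ` carrier (chain_group_deg0 \<Gamma>) \<subseteq> carrier (cochain_group_im \<Gamma>)"
    unfolding iota0_carrier_deg0 cochain_group_im_def using iota1_in_K1 by auto
  moreover have "carrier (chain_group_deg0 \<Gamma>) \<subseteq> carrier C0"
    by (auto simp: carrier_chain_group_deg0)
  ultimately show ?thesis
    using iota0_hom
    by (auto simp: hom_def cochain_group_im_def chain_group_deg0_def)
qed

lemmas iota_Cl0_hom =
  induced_Mod_hom[OF comm_group_chain_group_deg0 subgroup_im_laplace0_deg0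
    comm_group_cochain_group_im subgroup_im_box0_im iota0_hom_deg0 iota0_im_laplace0_subset,
    folded Cl0_def Clhat0_def iota_Cl0_def]

lemmas iota_Cl0_rcoset =
  induced_Mod_rcoset[OF comm_group_chain_group_deg0 subgroup_im_laplace0_deg0
    comm_group_cochain_group_im subgroup_im_box0_im iota0_hom_deg0 iota0_im_laplace0_subset,
    folded iota_Cl0_def]

text \<open>\<open>AJ\<close> ranges over all chains with boundary in the class. Such a chain
  differs from \<open>c\<close> by a cycle, which contributes an element of \<open>im_alpha\<close>,
  and by some \<open>bd_adj \<Gamma> x\<close>, which harmonic cochains do not see.\<close>

lemma AJ_rcoset_bd:
  assumes c: "Poly_Mapping.keys c \<subseteq> arcs \<Gamma>"
  shows "AJ \<Gamma> (im_laplace0 \<Gamma> #>\<^bsub>chain_group_deg0 \<Gamma>\<^esub> bd \<Gamma> c)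
    = im_alpha \<Gamma> #>\<^bsub>dual_group (Harm1 \<Gamma>)\<^esub> eval_harm \<Gamma> c"
  unfolding AJ_def
proof (rule induced_const)
  interpret D: comm_group "dual_group (Harm1 \<Gamma>)" by (rule comm_group_dual_Harm1)
  have coset: "X \<in> im_laplace0 \<Gamma> #>\<^bsub>chain_group_deg0 \<Gamma>\<^esub> bd \<Gamma> c
    \<longleftrightarrow> (\<exists>x. Poly_Mapping.keys x \<subseteq> verts \<Gamma> \<and> X = laplace0 \<Gamma> x + bd \<Gamma> c)" for X
    by (auto simp: r_coset_def im_laplace0_def chain_group_deg0_def) blast
  \<comment> \<open>The zero chain as \<open>x\<close> shows that \<open>c\<close> itself is among
    the competing chains.\<close>
  have "bd \<Gamma> c \<in> im_laplace0 \<Gamma> #>\<^bsub>chain_group_deg0 \<Gamma>\<^esub> bd \<Gamma> c"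
    unfolding coset by (intro exI[of _ 0]) (simp add: laplace0_def)
  then show "{\<gamma> \<in> carrier C1. bd \<Gamma> \<gamma> \<in> im_laplace0 \<Gamma> #>\<^bsub>chain_group_deg0 \<Gamma>\<^esub> bd \<Gamma> c} \<noteq> {}"
    using c by auto
  fix \<gamma> assume "\<gamma> \<in> {\<gamma> \<in> carrier C1. bd \<Gamma> \<gamma> \<in> im_laplace0 \<Gamma> #>\<^bsub>chain_group_deg0 \<Gamma>\<^esub> bd \<Gamma> c}"
  then obtain x where g: "Poly_Mapping.keys \<gamma> \<subseteq> arcs \<Gamma>" and x: "Poly_Mapping.keys x \<subseteq> verts \<Gamma>"
    "bd \<Gamma> \<gamma> = laplace0 \<Gamma> x + bd \<Gamma> c"
    using coset by auto
  \<comment> \<open>Since \<open>laplace0\<close> is \<open>bd\<close> after \<open>bd_adj\<close>,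
    removing \<open>bd_adj \<Gamma> x\<close> as well leaves a cycle.\<close>
  define z where "z = \<gamma> - c - bd_adj \<Gamma> x"
  have z: "z \<in> carrier (H_lower1 \<Gamma>)"
    using keys_diff[of \<gamma> c] keys_diff[of "\<gamma> - c" "bd_adj \<Gamma> x"] keys_bd_adj[OF x(1)] g c x(2)
    by (simp add: z_def carrier_H_lower1 bd_diff laplace0_def) blast
  then have zc: "z \<in> carrier C1" by (simp add: carrier_H_lower1)
  have cl: "eval_harm \<Gamma> c \<in> carrier (dual_group (Harm1 \<Gamma>))"
    by (rule hom_in_carrier[OF eval_harm_hom]) (simp add: c)
  have "\<gamma> = z + (bd_adj \<Gamma> x + c)" by (simp add: z_def)
  then have "eval_harm \<Gamma> \<gamma> = eval_harm \<Gamma> z \<otimes>\<^bsub>dual_group (Harm1 \<Gamma>)\<^esub>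
      (eval_harm \<Gamma> (bd_adj \<Gamma> x) \<otimes>\<^bsub>dual_group (Harm1 \<Gamma>)\<^esub> eval_harm \<Gamma> c)"
    by (simp add: eval_harm_def pairing_add fun_eq_iff)
  also have "\<dots> = eval_harm \<Gamma> z \<otimes>\<^bsub>dual_group (Harm1 \<Gamma>)\<^esub> eval_harm \<Gamma> c"
    using D.l_one[OF cl] eval_harm_bd_adj[OF x(1)] by metis
  finally have "eval_harm \<Gamma> \<gamma> \<in> im_alpha \<Gamma> #>\<^bsub>dual_group (Harm1 \<Gamma>)\<^esub> eval_harm \<Gamma> c"
    using z by (auto simp: r_coset_def im_alpha_def)
  then show "im_alpha \<Gamma> #>\<^bsub>dual_group (Harm1 \<Gamma>)\<^esub> eval_harm \<Gamma> \<gamma>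
      = im_alpha \<Gamma> #>\<^bsub>dual_group (Harm1 \<Gamma>)\<^esub> eval_harm \<Gamma> c"
    using D.repr_independence[OF _ cl subgroup_im_alpha] by simp
qed

section \<open>First cohomology as the dual of first homology\<close>

lemma cycle_pairing_surj: "cycle_pairing ` carrier K1 = carrier (dual_group (H_lower1 \<Gamma>))"
proof
  show "cycle_pairing ` carrier K1 \<subseteq> carrier (dual_group (H_lower1 \<Gamma>))"
    using hom_in_carrier[OF cycle_pairing_hom] by blast
  show "carrier (dual_group (H_lower1 \<Gamma>)) \<subseteq> cycle_pairing ` carrier K1"
  proof
    fix f assume f: "f \<in> carrier (dual_group (H_lower1 \<Gamma>))"
    let ?H = "carrier (H_lower1 \<Gamma>)"
    have add: "f (a + b) = f a + f b" if "a \<in> ?H" "b \<in> ?H" for a b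
      using f that hom_mult[of f "H_lower1 \<Gamma>" integer_group] by auto
    interpret H: subgroup ?H C1 by (rule subgroup_H_lower1)
    have f0: "f 0 = 0" using add[of 0 0] H.one_closed by simp
    have dcl: "a - b \<in> ?H" if "a \<in> ?H" "b \<in> ?H" for a b
      using that keys_diff[of a b] by (auto simp: carrier_H_lower1 bd_diff)
    have f_diff: "f (a - b) = f a - f b" if "a \<in> ?H" "b \<in> ?H" for a b
      using add[OF dcl[OF that] that(2)] by simp
    \<comment> \<open>The functional is extended from cycles to all chains by composing it with the
      projection onto cycles; \<open>w\<close> records its values on edges.\<close>
    define w where "w = (\<lambda>e\<in>arcs \<Gamma>. f (frag_of e - lift (bd \<Gamma> (frag_of e))))"
    have "pairing w c = f (c - lift (bd \<Gamma> c))" if "Poly_Mapping.keys c \<subseteq> arcs \<Gamma>" for c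
      using that
    proof (induction rule: chain_induct)
      case (diff a b)
      have "a - b - lift (bd \<Gamma> (a - b)) = (a - lift (bd \<Gamma> a)) - (b - lift (bd \<Gamma> b))"
        by (simp add: bd_diff lift_diff)
      then show ?case
        using diff f_diff[OF cycle_part cycle_part] by (simp only: pairing_diff)
    qed (simp_all add: f0 w_def)
    \<comment> \<open>On a cycle the correction is \<open>lift 0\<close>, which vanishes, so the
      extension restricts to \<open>f\<close>.\<close>
    then have "f = cycle_pairing w"
      using f by (auto simp: fun_eq_iff carrier_H_lower1 extensional_def)
    then show "f \<in> cycle_pairing ` carrier K1"
      by (auto simp: w_def)
  qed
qed

text \<open>Coboundaries vanish on cycles by \<open>pairing_cobd\<close>. Conversely, a cochain
  vanishing on cycles has a potential, obtained by integrating it along the chosen chains from the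
  root.\<close>

lemma cycle_pairing_kernel: "kernel K1 (dual_group (H_lower1 \<Gamma>)) cycle_pairing = im_cobd \<Gamma>"
proof (intro equalityI subsetI)
  fix w assume "w \<in> im_cobd \<Gamma>"
  then obtain f where f: "w = cobd \<Gamma> f" by (auto simp: im_cobd_def)
  show "w \<in> kernel K1 (dual_group (H_lower1 \<Gamma>)) cycle_pairing"
    unfolding f
    by (auto simp: kernel_def fun_eq_iff carrier_H_lower1 pairing_cobd) (simp add: cobd_def)
next
  fix w assume w: "w \<in> kernel K1 (dual_group (H_lower1 \<Gamma>)) cycle_pairing"
  define f where "f = (\<lambda>v\<in>verts \<Gamma>. pairing w (path_chain v))"
  have zero: "pairing w c = 0" if "c \<in> carrier (H_lower1 \<Gamma>)" for c
    using w that by (auto simp: kernel_def dest: fun_cong[of _ _ c])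
  \<comment> \<open>The projection of an edge to the cycles is the edge closed up by the chosen
    chains of its endpoints; vanishing of \<open>w\<close> there is the equation sought.\<close>
  have "w e = f (head \<Gamma> e) - f (tail \<Gamma> e)" if "e \<in> arcs \<Gamma>" for e
    using zero[OF cycle_part[of "frag_of e"]] that by (simp add: pairing_diff lift_diff f_def)
  then have "w = cobd \<Gamma> f"
    using w by (auto simp: fun_eq_iff cobd_def kernel_def extensional_def)
  then show "w \<in> im_cobd \<Gamma>" by (auto simp: im_cobd_def f_def)
qed

lemma H_upper1_to_dual_iso: "H_upper1_to_dual \<Gamma> \<in> iso (H_upper1 \<Gamma>) (dual_group (H_lower1 \<Gamma>))"
  unfolding H_upper1_to_dual_def H_upper1_def
  by (rule induced_iso[OF _ _ cycle_pairing_hom cycle_pairing_surj cycle_pairing_kernel])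
    (use comm_group_dual_H_lower1 in \<open>simp_all add: comm_group.axioms\<close>)

lemma H_upper1_to_dual_rcoset:
  assumes "w \<in> carrier K1"
  shows "H_upper1_to_dual \<Gamma> (im_cobd \<Gamma> #>\<^bsub>K1\<^esub> w) = cycle_pairing w"
  unfolding H_upper1_to_dual_def
proof (rule induced_rcoset[OF _ subgroup_im_cobd _ cycle_pairing_hom _ assms])
  show "cycle_pairing n = \<one>\<^bsub>dual_group (H_lower1 \<Gamma>)\<^esub>" if "n \<in> im_cobd \<Gamma>" for n
    using that unfolding cycle_pairing_kernel[symmetric] kernel_def by blast
qed (use comm_group_dual_H_lower1 in \<open>simp_all add: comm_group.axioms\<close>)

lemma dual_to_H_upper1_iso: "dual_to_H_upper1 \<Gamma> \<in> iso (dual_group (H_lower1 \<Gamma>)) (H_upper1 \<Gamma>)"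
  unfolding dual_to_H_upper1_def
  by (rule group.iso_set_sym[OF _ H_upper1_to_dual_iso])
    (simp add: comm_group_H_upper1 comm_group.axioms)

text \<open>Injectivity of \<open>H_upper1_to_dual\<close> forces the choice made by
  \<open>inv_into\<close>.\<close>

lemma dual_to_H_upper1_cycle_pairing:
  assumes "w \<in> carrier K1"
  shows "dual_to_H_upper1 \<Gamma> (cycle_pairing w) = im_cobd \<Gamma> #>\<^bsub>K1\<^esub> w"
proof -
  have "im_cobd \<Gamma> #>\<^bsub>K1\<^esub> w \<in> carrier (H_upper1 \<Gamma>)"
    by (rule hom_in_carrier[OF rcoset_im_cobd_hom assms])
  then show ?thesis
    unfolding dual_to_H_upper1_def H_upper1_to_dual_rcoset[OF assms, symmetric]
    using H_upper1_to_dual_iso by (simp add: iso_def bij_betw_def inv_into_f_f)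
qed

section \<open>The map \<open>zeta\<close> and the composite with \<open>AJ\<close> and
  \<open>chi\<close>\<close>

abbreviation zeta_lift :: "(('e \<Rightarrow> int) \<Rightarrow> int) \<Rightarrow> ('e \<Rightarrow> int) set" where
  "zeta_lift \<phi> \<equiv> dual_to_H_upper1 \<Gamma> (iota_transpose \<Gamma> \<phi>)"

lemma zeta_lift_eval_harm:
  assumes "Poly_Mapping.keys c \<subseteq> arcs \<Gamma>"
  shows "zeta_lift (eval_harm \<Gamma> c) = im_cobd \<Gamma> #>\<^bsub>K1\<^esub> iota1 \<Gamma> c"
  unfolding iota_transpose_eval_harm[OF assms]
  by (rule dual_to_H_upper1_cycle_pairing[OF iota1_in_K1])

lemma zeta_lift_hom: "zeta_lift \<in> hom (dual_group (Harm1 \<Gamma>)) (H_upper1 \<Gamma>)"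
  using Group.hom_compose[OF iota_transpose_hom] dual_to_H_upper1_iso
  by (fastforce simp: iso_def comp_def)

text \<open>Stated as an equality for two uses: it yields the inclusion in \<open>im_beta\<close>
  that makes \<open>zeta\<close> well defined, and equality with \<open>im_beta\<close> once
  \<open>iota1\<close> maps cycles onto harmonic cochains.\<close>

lemma zeta_lift_im_alpha:
  "zeta_lift ` im_alpha \<Gamma>
    = (\<lambda>w. im_cobd \<Gamma> #>\<^bsub>K1\<^esub> w) ` iota1 \<Gamma> ` carrier (H_lower1 \<Gamma>)"
  unfolding im_alpha_def image_image
  by (rule image_cong) (simp_all add: carrier_H_lower1 zeta_lift_eval_harm)

lemma zeta_rcoset:
  assumes "f \<in> carrier (dual_group (Harm1 \<Gamma>))"
  shows "zeta \<Gamma> (im_alpha \<Gamma> #>\<^bsub>dual_group (Harm1 \<Gamma>)\<^esub> f)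
    = im_beta \<Gamma> #>\<^bsub>H_upper1 \<Gamma>\<^esub> zeta_lift f"
  unfolding zeta_def
proof (rule induced_Mod_rcoset[OF comm_group_dual_Harm1 subgroup_im_alpha comm_group_H_upper1
      subgroup_im_beta zeta_lift_hom _ assms])
  show "zeta_lift ` im_alpha \<Gamma> \<subseteq> im_beta \<Gamma>"
    unfolding zeta_lift_im_alpha im_beta_def using iota1_Harm1 by blast
qed

lemma chi_zeta_AJ:
  assumes "x \<in> carrier (Cl0 \<Gamma>)"
  shows "chi \<Gamma> (zeta \<Gamma> (AJ \<Gamma> x)) = iota_Cl0 \<Gamma> x"
proof -
  obtain D where D: "D \<in> carrier (chain_group_deg0 \<Gamma>)"
    "x = im_laplace0 \<Gamma> #>\<^bsub>chain_group_deg0 \<Gamma>\<^esub> D"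
    using assms by (auto simp: Cl0_def carrier_FactGroup)
  \<comment> \<open>Connectedness supplies a chain with boundary \<open>D\<close>, and each map in
    the composite has an explicit value on the class it determines.\<close>
  then obtain c where c: "Poly_Mapping.keys c \<subseteq> arcs \<Gamma>" "D = bd \<Gamma> c"
    unfolding im_bd[symmetric] by auto
  have ev: "eval_harm \<Gamma> c \<in> carrier (dual_group (Harm1 \<Gamma>))"
    by (rule hom_in_carrier[OF eval_harm_hom]) (simp add: c)
  have "chi \<Gamma> (zeta \<Gamma> (AJ \<Gamma> x)) = im_box0 \<Gamma> #>\<^bsub>cochain_group_im \<Gamma>\<^esub> iota0 \<Gamma> D"
    unfolding D(2) c(2) AJ_rcoset_bd[OF c(1)] zeta_rcoset[OF ev] zeta_lift_eval_harm[OF c(1)]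
      chi_rcoset[OF iota1_in_K1] cobd_adj_iota1[OF c(1)] ..
  then show ?thesis using iota_Cl0_rcoset[OF D(1)] D(2) by simp
qed

end

section \<open>Finite graphs\<close>

locale connected_finite_graph = connected_locally_finite_graph \<Gamma> + fin_digraph \<Gamma>
  for \<Gamma> :: "('v, 'e) pre_digraph"
begin

lemma iota0_iso: "iota0 \<Gamma> \<in> iso C0 K0"
  unfolding iota0_def by (rule char_fun_iso) simp

lemma iota1_surj: "iota1 \<Gamma> ` carrier C1 = carrier K1"
  using char_fun_iso[of "arcs \<Gamma>"] unfolding iota1_def iso_def bij_betw_def by simp

lemma iota0_im_laplace0_eq: "iota0 \<Gamma> ` im_laplace0 \<Gamma> = im_box0 \<Gamma>"
  using iota0_iso unfolding iota0_im_laplace0 im_box0_def iso_def bij_betw_def by simp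

lemma iota_Cl_iso: "iota_Cl \<Gamma> \<in> iso (Cl \<Gamma>) (Clhat \<Gamma>)"
  unfolding iota_Cl_def Cl_def Clhat_def
  by (rule induced_Mod_iso[OF abelian_free_Abelian_group subgroup_im_laplace0
        comm_group_cochain_group subgroup_im_box0 iota0_iso iota0_im_laplace0_eq])

text \<open>Surjectivity comes from that of \<open>iota1\<close> on chains through
  \<open>iota0_carrier_deg0\<close>; injectivity is inherited from all chains.\<close>

lemma iota0_iso_deg0: "iota0 \<Gamma> \<in> iso (chain_group_deg0 \<Gamma>) (cochain_group_im \<Gamma>)"
proof -
  have "iota0 \<Gamma> ` carrier (chain_group_deg0 \<Gamma>) = carrier (cochain_group_im \<Gamma>)"
    unfolding iota0_carrier_deg0 iota1_surj by (simp add: cochain_group_im_def)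
  moreover have "inj_on (iota0 \<Gamma>) (carrier (chain_group_deg0 \<Gamma>))"
    unfolding iota0_def
    by (rule inj_on_subset[OF inj_on_char_fun]) (auto simp: carrier_chain_group_deg0)
  ultimately show ?thesis using iota0_hom_deg0 by (simp add: iso_def bij_betw_def)
qed

lemma iota_Cl0_iso: "iota_Cl0 \<Gamma> \<in> iso (Cl0 \<Gamma>) (Clhat0 \<Gamma>)"
  unfolding iota_Cl0_def Cl0_def Clhat0_def
  by (rule induced_Mod_iso[OF comm_group_chain_group_deg0 subgroup_im_laplace0_deg0
        comm_group_cochain_group_im subgroup_im_box0_im iota0_iso_deg0 iota0_im_laplace0_eq])

lemma iota1_iso: "iota1 \<Gamma> \<in> iso (H_lower1 \<Gamma>) (Harm1 \<Gamma>)"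
proof -
  have "inj_on (iota1 \<Gamma>) (carrier (H_lower1 \<Gamma>))"
    unfolding iota1_def by (rule inj_on_subset[OF inj_on_char_fun]) (auto simp: carrier_H_lower1)
  moreover have "carrier (Harm1 \<Gamma>) \<subseteq> iota1 \<Gamma> ` carrier (H_lower1 \<Gamma>)"
  proof
    fix w assume w: "w \<in> carrier (Harm1 \<Gamma>)"
    then have "w \<in> carrier K1" by (simp add: carrier_Harm1)
    then obtain c where c: "Poly_Mapping.keys c \<subseteq> arcs \<Gamma>" "w = iota1 \<Gamma> c"
      unfolding iota1_surj[symmetric] by auto
    \<comment> \<open>Harmonicity of \<open>w\<close> says that \<open>iota0\<close> sends the
      boundary of \<open>c\<close> to zero; injectivity of \<open>iota0\<close> then makes
      \<open>c\<close> a cycle.\<close>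
    then have "iota0 \<Gamma> (bd \<Gamma> c) = iota0 \<Gamma> 0"
      using w by (simp add: carrier_Harm1 cobd_adj_iota1) (simp add: iota0_def char_fun_def)
    then have "bd \<Gamma> c = 0"
      unfolding iota0_def by (rule inj_onD[OF inj_on_char_fun]) (simp_all add: keys_bd c)
    then show "w \<in> iota1 \<Gamma> ` carrier (H_lower1 \<Gamma>)" using c by (auto simp: carrier_H_lower1)
  qed
  ultimately show ?thesis using iota1_hom iota1_Harm1 by (auto simp: iso_def bij_betw_def)
qed

text \<open>Precomposition with an isomorphism is inverted by precomposition with its inverse, here
  \<open>j\<close>.\<close>

lemma iota_transpose_iso:
  "iota_transpose \<Gamma> \<in> iso (dual_group (Harm1 \<Gamma>)) (dual_group (H_lower1 \<Gamma>))"
proof -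
  have surj1: "iota1 \<Gamma> ` carrier (H_lower1 \<Gamma>) = carrier (Harm1 \<Gamma>)"
    and inj1: "inj_on (iota1 \<Gamma>) (carrier (H_lower1 \<Gamma>))"
    using iota1_iso by (auto simp: iso_def bij_betw_def)
  define j where "j = inv_into (carrier (H_lower1 \<Gamma>)) (iota1 \<Gamma>)"
  have j_hom: "j \<in> hom (Harm1 \<Gamma>) (H_lower1 \<Gamma>)"
    using group.iso_set_sym[OF comm_group.axioms(2)[OF comm_group_H_lower1] iota1_iso]
    by (simp add: j_def iso_def)
  have "inj_on (iota_transpose \<Gamma>) (carrier (dual_group (Harm1 \<Gamma>)))"
  proof (rule inj_onI)
    fix f g assume fg: "f \<in> carrier (dual_group (Harm1 \<Gamma>))" "g \<in> carrier (dual_group (Harm1 \<Gamma>))"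
      "iota_transpose \<Gamma> f = iota_transpose \<Gamma> g"
    have "f (iota1 \<Gamma> c) = g (iota1 \<Gamma> c)" if "c \<in> carrier (H_lower1 \<Gamma>)" for c
      using fun_cong[OF fg(3), of c] that by (simp add: iota_transpose_def)
    then have "f w = g w" if "w \<in> carrier (Harm1 \<Gamma>)" for w
      using that unfolding surj1[symmetric] by blast
    then show "f = g" using fg(1,2) by (auto intro: extensionalityI)
  qed
  moreover have "carrier (dual_group (H_lower1 \<Gamma>))
      \<subseteq> iota_transpose \<Gamma> ` carrier (dual_group (Harm1 \<Gamma>))"
  proof
    fix f assume f: "f \<in> carrier (dual_group (H_lower1 \<Gamma>))"
    \<comment> \<open>The restriction makes the preimage extensional, as membership in the dual
      group demands.\<close>
    let ?g = "restrict (f \<circ> j) (carrier (Harm1 \<Gamma>))"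
    have "f \<circ> j \<in> hom (Harm1 \<Gamma>) integer_group"
      using f by (intro Group.hom_compose[OF j_hom]) simp
    then have "?g \<in> carrier (dual_group (Harm1 \<Gamma>))"
      using group.is_monoid[OF comm_group.axioms(2)[OF comm_group_Harm1]]
      by (auto simp: hom_def monoid.m_closed simp del: mult_Harm1)
    moreover have "f = iota_transpose \<Gamma> ?g"
      using f iota1_Harm1 inj1
      by (auto simp: iota_transpose_def fun_eq_iff j_def inv_into_f_f extensional_def)
    ultimately show "f \<in> iota_transpose \<Gamma> ` carrier (dual_group (Harm1 \<Gamma>))" by blast
  qed
  moreover have "iota_transpose \<Gamma> ` carrier (dual_group (Harm1 \<Gamma>))
      \<subseteq> carrier (dual_group (H_lower1 \<Gamma>))"
    using hom_in_carrier[OF iota_transpose_hom] by blast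
  ultimately show ?thesis
    using iota_transpose_hom unfolding iso_def bij_betw_def by blast
qed

text \<open>The lift of \<open>zeta\<close> is already an isomorphism, and it matches the subgroups
  divided out because \<open>iota1\<close> carries cycles onto harmonic cochains.\<close>

lemma zeta_iso: "zeta \<Gamma> \<in> iso (Jgrp \<Gamma>) (Pgrp \<Gamma>)"
  unfolding zeta_def Jgrp_def Pgrp_def
proof (rule induced_Mod_iso[OF comm_group_dual_Harm1 subgroup_im_alpha comm_group_H_upper1
      subgroup_im_beta])
  show "zeta_lift \<in> iso (dual_group (Harm1 \<Gamma>)) (H_upper1 \<Gamma>)"
    using iso_set_trans[OF iota_transpose_iso dual_to_H_upper1_iso] by (simp add: comp_def)
  have "iota1 \<Gamma> ` carrier (H_lower1 \<Gamma>) = carrier (Harm1 \<Gamma>)"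
    using iota1_iso by (simp add: iso_def bij_betw_def)
  then show "zeta_lift ` im_alpha \<Gamma> = im_beta \<Gamma>"
    unfolding zeta_lift_im_alpha im_beta_def by simp
qed

end

theorem theorem2p4p7:
  fixes \<Gamma> :: "('v, 'e) pre_digraph"
  assumes "locally_finite_graph \<Gamma>" and "Digraph_Component.connected \<Gamma>"
  shows "iota_Cl \<Gamma> \<in> hom (Cl \<Gamma>) (Clhat \<Gamma>)
    \<and> (\<forall>D\<in>carrier (chain_group (verts \<Gamma>)).
         iota_Cl \<Gamma> (im_laplace0 \<Gamma> #>\<^bsub>chain_group (verts \<Gamma>)\<^esub> D)
           = im_box0 \<Gamma> #>\<^bsub>cochain_group (verts \<Gamma>)\<^esub> iota0 \<Gamma> D)
    \<and> iota_Cl0 \<Gamma> \<in> hom (Cl0 \<Gamma>) (Clhat0 \<Gamma>)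
    \<and> (\<forall>D\<in>carrier (chain_group_deg0 \<Gamma>).
         iota_Cl0 \<Gamma> (im_laplace0 \<Gamma> #>\<^bsub>chain_group_deg0 \<Gamma>\<^esub> D)
           = im_box0 \<Gamma> #>\<^bsub>cochain_group_im \<Gamma>\<^esub> iota0 \<Gamma> D)
    \<and> (\<forall>x\<in>carrier (Cl0 \<Gamma>). iota_Cl0 \<Gamma> x = iota_Cl \<Gamma> x)
    \<and> (\<forall>x\<in>carrier (Cl0 \<Gamma>). (chi \<Gamma> \<circ> zeta \<Gamma> \<circ> AJ \<Gamma>) x = iota_Cl0 \<Gamma> x)
    \<and> (fin_digraph \<Gamma> \<longrightarrow>
         iota_Cl \<Gamma> \<in> iso (Cl \<Gamma>) (Clhat \<Gamma>)
       \<and> iota_Cl0 \<Gamma> \<in> iso (Cl0 \<Gamma>) (Clhat0 \<Gamma>)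
       \<and> zeta \<Gamma> \<in> iso (Jgrp \<Gamma>) (Pgrp \<Gamma>))"
proof -
  interpret connected_locally_finite_graph \<Gamma>
    using assms by (simp add: connected_locally_finite_graph_def
        connected_locally_finite_graph_axioms_def)
  have fin: "connected_finite_graph \<Gamma>" if "fin_digraph \<Gamma>"
    using that connected_locally_finite_graph_axioms by (simp add: connected_finite_graph_def)
  show ?thesis
    using iota_Cl_hom iota_Cl_rcoset iota_Cl0_hom iota_Cl0_rcoset iota_Cl0_eq_iota_Cl chi_zeta_AJ
      connected_finite_graph.iota_Cl_iso[OF fin] connected_finite_graph.iota_Cl0_iso[OF fin]
      connected_finite_graph.zeta_iso[OF fin]
    by (intro conjI ballI impI) (simp_all only: comp_apply)
qed

end
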